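(* Let $0<p<1/2$, $\rho=(1-p)/p$, $g_\rho(x)=\rho^x-1$. Let $\mathcal{M}^\rho$ be the set of probability measures $\mu$ on $\mathbb{Z}$ for which there exists a randomized stopping time $\tau$ such that $S_\tau\sim\mu$ and $(S_{\tau\wedge t})_{t\in\mathbb{N}}$ is uniformly integrable. Let $$\widetilde{\mathcal{M}}^\rho := \Big\{\mu \text{ measure on } \mathbb{Z}: \sum_{y\in\mathbb{Z}}\mu(\{y\})=1,\ \sum_{y\in\mathbb{Z}}|y|\,\mu(\{y\})<\infty,\ \sum_{y\in\mathbb{Z}} g_\rho(y)\,\mu(\{y\})\le 0\Big\}.$$ Then $\mathcal{M}^\rho\subseteq\widetilde{\mathcal{M}}^\rho$.
   Context: $(S_t)_{t\in\mathbb{N}}$ is the asymmetric simple random walk: $S_0=0$, with i.i.d. increments equal to $+1$ with probability $p$ and $-1$ with probability $1-p$. $(\mathcal{F}_t)$ is its natural filtration. The probability space is rich enough to carry, in addition, for each $t\in\mathbb{N}$ and each possible history $h=(s_0,\dots,s_t)$ of the walk, a $\{0,1\}$-valued Bernoulli random variable $\xi_t^h$, all of these being mutually independent and independent of $(S_t)$; their success probabilities may be chosen freely. Put $\mathcal{G}_t=\mathcal{F}_t\vee\sigma(\xi_s^{(S_0,\dots,S_s)}, s\le t)$. A randomized stopping time is a $\{0,1,2,\dots\}\cup\{\infty\}$-valued stopping time with respect to $(\mathcal{G}_t)$ for some such choice of Bernoulli variables. On $\{\tau=\infty\}$, $S_\tau$ is understood as $\lim_{t\to\infty}S_t=-\infty$.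 *)

theory Defs
  imports "HOL-Probability.Probability"
begin

definition possible_histories :: "nat \<Rightarrow> int list set" where
  "possible_histories t =
     {h. length h = Suc t \<and> h ! 0 = 0 \<and> (\<forall>i<t. h ! Suc i - h ! i \<in> {1, -1})}"

definition history :: "(nat \<Rightarrow> 'a \<Rightarrow> int) \<Rightarrow> nat \<Rightarrow> 'a \<Rightarrow> int list" where
  "history S t \<omega> = map (\<lambda>s. S s \<omega>) [0..<Suc t]"

text \<open>
  \<open>bernoulli_family M S q \<xi>\<close>: the variables \<open>\<xi> t h\<close>, for \<open>h\<close> a possible history up to time
  \<open>t\<close>, are Bernoulli with success probability \<open>q t h\<close>, mutually independent and jointly
  independent of the process \<open>S\<close>. The value 1 is represented by \<open>True\<close>. Nothing is required
  of \<open>\<xi> t h\<close> when \<open>h\<close> is not a possible history.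
\<close>

definition bernoulli_family ::
  "'a measure \<Rightarrow> (nat \<Rightarrow> 'a \<Rightarrow> int) \<Rightarrow> (nat \<Rightarrow> int list \<Rightarrow> real)
     \<Rightarrow> (nat \<Rightarrow> int list \<Rightarrow> 'a \<Rightarrow> bool) \<Rightarrow> bool" where
  "bernoulli_family M S q \<xi> \<longleftrightarrow>
     (let I = (SIGMA t:UNIV. possible_histories t) in
       (\<forall>(t, h)\<in>I. q t h \<in> {0..1} \<and>
          distr M (count_space UNIV) (\<xi> t h) = measure_pmf (bernoulli_pmf (q t h))) \<and>
       prob_space.indep_vars M (\<lambda>_. count_space UNIV) (\<lambda>(t, h). \<xi> t h) I \<and>
       prob_space.indep_set M
         (sets (SUP t. vimage_algebra (space M) (S t) (count_space UNIV)))
         (sets (SUP (t, h)\<in>I. vimage_algebra (space M) (\<xi> t h) (count_space UNIV))))"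

text \<open>
  The last assumption is the richness of the underlying probability space: a family of Bernoulli
  variables as above exists on it for every choice of the success probabilities.
\<close>

locale rich_asymmetric_walk = prob_space M
  for M :: "'a measure" and S :: "nat \<Rightarrow> 'a \<Rightarrow> int" and p :: real +
  assumes start: "\<And>\<omega>. \<omega> \<in> space M \<Longrightarrow> S 0 \<omega> = 0"
    and step: "\<And>t \<omega>. \<omega> \<in> space M \<Longrightarrow> S (Suc t) \<omega> - S t \<omega> \<in> {1, -1}"
    and indep_increments:
      "indep_vars (\<lambda>_. count_space UNIV) (\<lambda>t \<omega>. S (Suc t) \<omega> - S t \<omega>) UNIV"
    and prob_up: "\<And>t. prob {\<omega> \<in> space M. S (Suc t) \<omega> - S t \<omega> = 1} = p"
    and prob_down: "\<And>t. prob {\<omega> \<in> space M. S (Suc t) \<omega> - S t \<omega> = -1} = 1 - p"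
    and rich: "\<And>q :: nat \<Rightarrow> int list \<Rightarrow> real.
      (\<And>t h. h \<in> possible_histories t \<Longrightarrow> q t h \<in> {0..1}) \<Longrightarrow> \<exists>\<xi>. bernoulli_family M S q \<xi>"

definition natural_filtration ::
  "'a measure \<Rightarrow> (nat \<Rightarrow> 'a \<Rightarrow> int) \<Rightarrow> nat \<Rightarrow> 'a measure" where
  "natural_filtration M S t = (SUP s\<in>{..t}. vimage_algebra (space M) (S s) (count_space UNIV))"

definition enlarged_filtration ::
  "'a measure \<Rightarrow> (nat \<Rightarrow> 'a \<Rightarrow> int) \<Rightarrow> (nat \<Rightarrow> int list \<Rightarrow> 'a \<Rightarrow> bool) \<Rightarrow> nat \<Rightarrow> 'a measure"
where
  "enlarged_filtration M S \<xi> t =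
     sup (natural_filtration M S t)
       (SUP s\<in>{..t}. vimage_algebra (space M) (\<lambda>\<omega>. \<xi> s (history S s \<omega>) \<omega>) (count_space UNIV))"

text \<open>
  The constant \<open>stopping_time\<close> of the library has the same type for the values of the stopping
  time and the index of the filtration; here the values are in \<open>enat\<close> and the index is in \<open>nat\<close>.
\<close>

definition randomized_stopping_time ::
  "'a measure \<Rightarrow> (nat \<Rightarrow> 'a \<Rightarrow> int) \<Rightarrow> ('a \<Rightarrow> enat) \<Rightarrow> bool" where
  "randomized_stopping_time M S \<tau> \<longleftrightarrow>
     (\<exists>q \<xi>. bernoulli_family M S q \<xi> \<and>
       (\<forall>t. Measurable.pred (enlarged_filtration M S \<xi> t) (\<lambda>\<omega>. \<tau> \<omega> \<le> enat t)))"

definition terminal_value :: "(nat \<Rightarrow> 'a \<Rightarrow> int) \<Rightarrow> ('a \<Rightarrow> enat) \<Rightarrow> 'a \<Rightarrow> ereal" where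
  "terminal_value S \<tau> \<omega> =
     (case \<tau> \<omega> of enat t \<Rightarrow> ereal (of_int (S t \<omega>)) | \<infinity> \<Rightarrow> -\<infinity>)"

definition stopped_walk :: "(nat \<Rightarrow> 'a \<Rightarrow> int) \<Rightarrow> ('a \<Rightarrow> enat) \<Rightarrow> nat \<Rightarrow> 'a \<Rightarrow> real" where
  "stopped_walk S \<tau> t \<omega> = of_int (S (the_enat (min (\<tau> \<omega>) (enat t))) \<omega>)"

definition uniformly_integrable :: "'a measure \<Rightarrow> 'i set \<Rightarrow> ('i \<Rightarrow> 'a \<Rightarrow> real) \<Rightarrow> bool" where
  "uniformly_integrable M I X \<longleftrightarrow>
     (\<forall>i\<in>I. X i \<in> borel_measurable M) \<and>
     ((\<lambda>K::real. SUP i\<in>I. \<integral>\<^sup>+ \<omega>. ennreal \<bar>X i \<omega>\<bar> * indicator {\<omega>. K \<le> \<bar>X i \<omega>\<bar>} \<omega> \<partial>M)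
        \<longlongrightarrow> 0) at_top"

text \<open>
  The law of the terminal value is compared with \<open>\<mu>\<close> on the extended reals, so that a terminal
  value equal to \<open>-\<infinity>\<close> with positive probability is excluded.
\<close>

definition attainable_laws :: "'a measure \<Rightarrow> (nat \<Rightarrow> 'a \<Rightarrow> int) \<Rightarrow> int measure set" where
  "attainable_laws M S =
     {\<mu>. sets \<mu> = UNIV \<and> prob_space \<mu> \<and>
       (\<exists>\<tau>. randomized_stopping_time M S \<tau> \<and>
         distr M borel (terminal_value S \<tau>) = distr \<mu> borel (\<lambda>y. ereal (of_int y)) \<and>
         uniformly_integrable M UNIV (stopped_walk S \<tau>))}"

definition g :: "real \<Rightarrow> real \<Rightarrow> real" where
  "g \<rho> x = \<rho> powr x - 1"

text \<open>
  The first sum is in \<open>ennreal\<close>, so it forces all point masses to be finite. The other two sums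
  are real, where \<open>summable_on\<close> is absolute summability: it expresses finiteness of the second
  sum. The third one, having terms bounded below by \<open>-\<mu> {y}\<close>, is always defined in
  \<open>(-\<infinity>, \<infinity>]\<close>; being at most 0 includes its convergence.
\<close>

definition candidate_laws :: "real \<Rightarrow> int measure set" where
  "candidate_laws \<rho> =
     {\<mu>. sets \<mu> = UNIV \<and>
       (\<Sum>\<^sub>\<infinity>y\<in>UNIV. emeasure \<mu> {y}) = 1 \<and>
       (\<lambda>y. \<bar>real_of_int y\<bar> * measure \<mu> {y}) summable_on UNIV \<and>
       (\<lambda>y. g \<rho> (of_int y) * measure \<mu> {y}) summable_on UNIV \<and>
       (\<Sum>\<^sub>\<infinity>y\<in>UNIV. g \<rho> (of_int y) * measure \<mu> {y}) \<le> 0}"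

end

theory Submission
  imports Defs
begin

text \<open>
  Each increment of the walk is independent of the enlarged filtration, and the expectation of
  \<open>\<rho> powr X\<close> is 1 for an increment \<open>X\<close>. So \<open>\<rho> powr S\<close> stopped at \<open>\<tau>\<close> has expectation 1 at all
  times, and Fatou's lemma bounds the expectation of \<open>\<rho> powr S\<^sub>\<tau>\<close> by 1. Fatou's lemma also gives
  the first moment of \<open>S\<^sub>\<tau>\<close>, because uniform integrability bounds the first absolute moments of
  the stopped walk. As the law of \<open>S\<^sub>\<tau>\<close> lives on the integers, \<open>\<tau>\<close> is almost surely finite, so
  the stopped walk is eventually constant.
\<close>

section \<open>Integrals over countable spaces as sums of point masses\<close>

text \<open>On a countable space whose subsets are all measurable, a finite measure has its point
  masses as density with respect to counting measure. This turns the integrals of the probabilistic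
  argument into the sums in \<open>candidate_laws\<close>.\<close>

lemma integral_countable_infsum:
  fixes f :: "'b::countable \<Rightarrow> real"
  assumes \<mu>: "finite_measure \<mu>" "sets \<mu> = UNIV" and f: "integrable \<mu> f"
  shows "(\<lambda>y. f y * measure \<mu> {y}) summable_on UNIV"
    and "(\<Sum>\<^sub>\<infinity>y\<in>UNIV. f y * measure \<mu> {y}) = integral\<^sup>L \<mu> f"
proof -
  interpret finite_measure \<mu> by fact
  have eq: "\<mu> = density (count_space UNIV) (\<lambda>y. ennreal (measure \<mu> {y}))"
    by (rule measure_eqI_countable[where A = UNIV])
       (auto simp: \<mu>(2) emeasure_density emeasure_eq_measure[symmetric]
          nn_integral_indicator_singleton)
  have "integrable (count_space UNIV) (\<lambda>y. measure \<mu> {y} *\<^sub>R f y)"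
    using f by (subst (asm) eq) (simp add: integrable_density)
  \<comment> \<open>Integrability over counting measure is absolute summability in the sense of
    \<open>infsetsum\<close>; the conversion to \<open>summable_on\<close> and \<open>infsum\<close>
    follows.\<close>
  then have abs: "Infinite_Set_Sum.abs_summable_on (\<lambda>y. f y * measure \<mu> {y}) UNIV"
    by (simp add: Infinite_Set_Sum.abs_summable_on_def mult.commute)
  then show "(\<lambda>y. f y * measure \<mu> {y}) summable_on UNIV"
    using abs_summable_equivalent abs_summable_summable by blast
  have "integral\<^sup>L \<mu> f = integral\<^sup>L (count_space UNIV) (\<lambda>y. measure \<mu> {y} *\<^sub>R f y)"
    by (subst eq) (simp add: integral_density)
  also have "\<dots> = infsetsum (\<lambda>y. f y * measure \<mu> {y}) UNIV"
    by (simp add: infsetsum_def mult.commute)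
  finally show "(\<Sum>\<^sub>\<infinity>y\<in>UNIV. f y * measure \<mu> {y}) = integral\<^sup>L \<mu> f"
    using infsetsum_infsum[OF abs] by simp
qed

text \<open>Both sides are the supremum of the finite partial sums, and nonnegativity lets
  \<open>ennreal\<close> commute with each of these.\<close>

lemma infsum_ennreal_eq:
  assumes "f summable_on A" "\<And>x. x \<in> A \<Longrightarrow> f x \<ge> 0"
  shows "(\<Sum>\<^sub>\<infinity>x\<in>A. ennreal (f x)) = ennreal (infsum f A)"
proof -
  have "(\<Sum>\<^sub>\<infinity>x\<in>A. ennreal (f x)) = (SUP F\<in>{F. finite F \<and> F \<subseteq> A}. \<Sum>x\<in>F. ennreal (f x))"
    by (rule nonneg_infsum_complete) simp
  also have "\<dots> = (SUP F\<in>{F. finite F \<and> F \<subseteq> A}. ennreal (sum f F))"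
    by (intro SUP_cong refl sum_ennreal) (use assms(2) in auto)
  also have "\<dots> = ennreal (infsum f A)"
    by (rule infsum_nonneg_is_SUPREMUM_ennreal[OF assms, symmetric])
  finally show ?thesis .
qed

lemma infsum_emeasure_singletons:
  fixes \<mu> :: "'b::countable measure"
  assumes "prob_space \<mu>" "sets \<mu> = UNIV"
  shows "(\<Sum>\<^sub>\<infinity>y\<in>UNIV. emeasure \<mu> {y}) = 1"
proof -
  interpret prob_space \<mu> by fact
  have *: "(\<lambda>y. measure \<mu> {y}) summable_on UNIV" "(\<Sum>\<^sub>\<infinity>y\<in>UNIV. measure \<mu> {y}) = 1"
    using integral_countable_infsum[OF finite_measure_axioms assms(2), of "\<lambda>_. 1"]
    by (simp_all add: prob_space)
  show ?thesis
    using infsum_ennreal_eq[OF *(1)] *(2) by (simp add: emeasure_eq_measure)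
qed

section \<open>Independence, generated sigma-algebras and uniform integrability\<close>

lemma (in prob_space) indep_set_mono:
  "indep_set A B \<Longrightarrow> A' \<subseteq> A \<Longrightarrow> B' \<subseteq> B \<Longrightarrow> indep_set A' B'"
  unfolding indep_sets2_eq by blast

text \<open>This is the product formula for finitely many independent variables, read over the index
  type \<open>bool\<close>. In \<open>ennreal\<close> no integrability has to be checked when it is
  applied.\<close>

lemma (in prob_space) indep_var_nn_integral:
  fixes U V :: "'a \<Rightarrow> ennreal"
  assumes "indep_var borel U borel V"
  shows "(\<integral>\<^sup>+\<omega>. U \<omega> * V \<omega> \<partial>M) = (\<integral>\<^sup>+\<omega>. U \<omega> \<partial>M) * (\<integral>\<^sup>+\<omega>. V \<omega> \<partial>M)"
proof -
  have "case_bool borel borel = (\<lambda>_. borel :: ennreal measure)"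
    by (auto simp: fun_eq_iff split: bool.split)
  then have "indep_vars (\<lambda>_. borel) (case_bool U V) UNIV"
    using assms by (simp add: indep_var_def)
  from indep_vars_nn_integral[OF _ this] show ?thesis
    by (simp add: UNIV_bool mult.commute)
qed

lemma sets_SUP_vimage_algebra_subset:
  assumes "I \<noteq> {}" "\<And>i. i \<in> I \<Longrightarrow> f i \<in> measurable N (F i)"
  shows "sets (SUP i\<in>I. vimage_algebra (space N) (f i) (F i)) \<subseteq> sets N"
proof (rule sets_Sup_in_sets)
  fix m assume "m \<in> (\<lambda>i. vimage_algebra (space N) (f i) (F i)) ` I"
  then obtain i where "i \<in> I" "m = vimage_algebra (space N) (f i) (F i)" by auto
  then show "space m = space N" "sets m \<subseteq> sets N"
    using sets_image_in_sets[OF refl assms(2)] by simp_all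
qed (use assms(1) in simp)

text \<open>The supremum of an empty family has empty space, whence the condition on
  \<open>I\<close>.\<close>

lemma space_SUP_vimage_algebra:
  assumes "I \<noteq> {}"
  shows "space (SUP i\<in>I. vimage_algebra \<Omega> (f i) (F i)) = \<Omega>"
  using assms by (subst space_Sup_eq_UN) auto

lemma measurable_SUP_vimage_algebra:
  assumes "i \<in> I" "f i \<in> \<Omega> \<rightarrow> space (F i)"
  shows "f i \<in> measurable (SUP i\<in>I. vimage_algebra \<Omega> (f i) (F i)) (F i)"
  using assms by (intro measurable_SUP1[OF assms(1)] measurable_vimage_algebra1) auto

text \<open>If all tails beyond \<open>K\<close> are below 1, splitting each variable at
  \<open>K\<close> bounds its first absolute moment by \<open>K + 1\<close>.\<close>

lemma uniformly_integrable_bounded: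
  assumes "prob_space M" "uniformly_integrable M I X"
  obtains C :: real where "\<And>i. i \<in> I \<Longrightarrow> (\<integral>\<^sup>+\<omega>. ennreal \<bar>X i \<omega>\<bar> \<partial>M) \<le> ennreal C"
proof -
  interpret prob_space M by fact
  let ?T = "\<lambda>K::real. \<lambda>i. \<integral>\<^sup>+ \<omega>. ennreal \<bar>X i \<omega>\<bar> * indicator {\<omega>. K \<le> \<bar>X i \<omega>\<bar>} \<omega> \<partial>M"
  have meas: "\<And>i. i \<in> I \<Longrightarrow> X i \<in> borel_measurable M"
    and lim: "((\<lambda>K. SUP i\<in>I. ?T K i) \<longlongrightarrow> 0) at_top"
    using assms(2) by (auto simp: uniformly_integrable_def)
  have "\<forall>\<^sub>F K in at_top. (SUP i\<in>I. ?T K i) < 1"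
    using order_tendstoD(2)[OF lim, of 1] by simp
  \<comment> \<open>With \<open>K\<close> nonnegative, \<open>ennreal K + 1\<close> is
    \<open>ennreal (K + 1)\<close>.\<close>
  then have "\<forall>\<^sub>F K in at_top. (SUP i\<in>I. ?T K i) < 1 \<and> K \<ge> 0"
    using eventually_ge_at_top[of 0] by eventually_elim simp
  then obtain K where K: "(SUP i\<in>I. ?T K i) < 1" "K \<ge> 0"
    by (auto simp: eventually_at_top_linorder)
  have "(\<integral>\<^sup>+\<omega>. ennreal \<bar>X i \<omega>\<bar> \<partial>M) \<le> ennreal (K + 1)" if i: "i \<in> I" for i
  proof -
    note [measurable] = meas[OF i]
    have "(\<integral>\<^sup>+\<omega>. ennreal \<bar>X i \<omega>\<bar> \<partial>M)
        \<le> (\<integral>\<^sup>+\<omega>. ennreal K + ennreal \<bar>X i \<omega>\<bar> * indicator {\<omega>. K \<le> \<bar>X i \<omega>\<bar>} \<omega> \<partial>M)"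
      using K(2) by (intro nn_integral_mono) (auto simp: indicator_def intro!: ennreal_leI)
    also have "\<dots> = ennreal K + ?T K i"
      by (subst nn_integral_add) (auto simp: emeasure_space_1)
    also have "\<dots> \<le> ennreal K + 1"
      using K(1) SUP_upper[OF i, of "?T K"] by (intro add_left_mono) simp
    finally show ?thesis
      using K(2) by simp
  qed
  then show thesis by (rule that)
qed

section \<open>The walk, its filtrations and independence of the next increment\<close>

context rich_asymmetric_walk
begin

text \<open>The walk is the sum of its increments. The sigma-algebra \<open>N\<close> is left open
  to cover both \<open>M\<close> and the one generated by the increments before time
  \<open>t\<close>.\<close>

lemma measurable_walk:
  assumes N: "space N = space M"
    and meas: "\<And>i. i < t \<Longrightarrow> (\<lambda>\<omega>. S (Suc i) \<omega> - S i \<omega>) \<in> measurable N (count_space UNIV)"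
    and "s \<le> t"
  shows "S s \<in> measurable N (count_space UNIV)"
  using \<open>s \<le> t\<close>
proof (induction s)
  case 0
  have "(\<lambda>_. 0) \<in> measurable N (count_space UNIV)" by simp
  then show ?case
    by (rule measurable_cong[THEN iffD1, rotated]) (simp add: start N)
next
  case (Suc s)
  have [measurable]: "S s \<in> measurable N (count_space UNIV)"
    "(\<lambda>\<omega>. S (Suc s) \<omega> - S s \<omega>) \<in> measurable N (count_space UNIV)"
    using Suc meas by auto
  have "(\<lambda>\<omega>. S s \<omega> + (S (Suc s) \<omega> - S s \<omega>)) \<in> measurable N (count_space UNIV)"
    by measurable
  then show ?case by simp
qed

lemma measurable_increment:
  "(\<lambda>\<omega>. S (Suc t) \<omega> - S t \<omega>) \<in> measurable M (count_space UNIV)"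
  using indep_increments by (auto simp: indep_vars_def2)

lemma measurable_S: "S t \<in> measurable M (count_space UNIV)"
  by (rule measurable_walk[where t = t]) (auto simp: measurable_increment)

text \<open>The index blocks \<open>{t}\<close> and \<open>{..<t}\<close> are disjoint, so the
  increments over them are independent. The second block determines the walk up to time
  \<open>t\<close>, because the walk starts at 0.\<close>

lemma indep_increment_natural_filtration:
  "indep_set {(\<lambda>\<omega>. S (Suc t) \<omega> - S t \<omega>) -` A \<inter> space M | A. True} (sets (natural_filtration M S t))"
proof -
  let ?X = "\<lambda>i \<omega>. S (Suc i) \<omega> - S i \<omega>" and ?C = "\<lambda>_::nat. count_space (UNIV :: int set)"
  let ?R = "\<lambda>\<omega>. restrict (\<lambda>i. ?X i \<omega>) {..<t}"
  let ?Q = "{(\<lambda>\<omega>. restrict (\<lambda>i. ?X i \<omega>) {t}) -` A \<inter> space M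
    | A. A \<in> sets (PiM {t} ?C)}"
  let ?N = "vimage_algebra (space M) ?R (PiM {..<t} ?C)"
  have "indep_var (PiM {t} ?C) (\<lambda>\<omega>. restrict (\<lambda>i. ?X i \<omega>) {t}) (PiM {..<t} ?C) ?R"
    by (rule indep_var_restrict[OF indep_increments]) auto
  then have "indep_set (sigma_sets (space M) ?Q)
      (sets ?N)"
    by (simp add: indep_var_eq sets_vimage_algebra)
  moreover have "{?X t -` A \<inter> space M | A. True} \<subseteq>
      sigma_sets (space M) ?Q"
  proof safe
    fix A :: "int set"
    \<comment> \<open>An event of the single increment is rewritten as the preimage of a cylinder in
      the one-factor product space.\<close>
    have "(\<lambda>x. x t) -` A \<inter> space (PiM {t} ?C) \<in> sets (PiM {t} ?C)"
      by (rule measurable_sets[OF measurable_component_singleton]) auto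
    moreover have "?X t -` A \<inter> space M =
        (\<lambda>\<omega>. restrict (\<lambda>i. ?X i \<omega>) {t}) -` ((\<lambda>x. x t) -` A \<inter> space (PiM {t} ?C)) \<inter> space M"
      by (auto simp: space_PiM)
    ultimately show "?X t -` A \<inter> space M \<in>
      sigma_sets (space M) ?Q"
      by blast
  qed
  moreover have "sets (natural_filtration M S t) \<subseteq> sets ?N"
  proof -
    have comp: "?X i \<in> measurable ?N (count_space UNIV)" if "i < t" for i
    proof -
      have "(\<lambda>\<omega>. ?R \<omega> i) \<in> measurable ?N (count_space UNIV)"
        by (rule measurable_compose[OF measurable_vimage_algebra1 measurable_component_singleton])
           (use that in \<open>auto simp: space_PiM simp del: restrict_apply\<close>)
      then show ?thesis using that by simp
    qed
    have "sets (SUP s\<in>{..t}. vimage_algebra (space ?N) (S s) (count_space UNIV)) \<subseteq> sets ?N"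
      by (rule sets_SUP_vimage_algebra_subset) (auto intro!: measurable_walk[where t = t] comp)
    then show ?thesis by (simp add: natural_filtration_def)
  qed
  ultimately show ?thesis
    by (rule indep_set_mono)
qed

lemma history_possible: "\<omega> \<in> space M \<Longrightarrow> history S t \<omega> \<in> possible_histories t"
  using step start by (auto simp: possible_histories_def history_def nth_append simp del: upt_Suc)

text \<open>There are only countably many histories, and having a given one is a finite intersection
  of events of the walk. The target is restricted to possible histories because only there is \<xi>
  known to be measurable.\<close>

lemma measurable_history:
  assumes N: "space N = space M" and S: "\<And>s. s \<le> t \<Longrightarrow> S s \<in> measurable N (count_space UNIV)"
  shows "history S t \<in> measurable N (count_space (possible_histories t))"
proof -
  have "history S t -` {h} \<inter> space N \<in> sets N" if "h \<in> possible_histories t" for h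
  proof -
    have "history S t -` {h} \<inter> space N = (\<Inter>i\<in>{..t}. S i -` {h ! i} \<inter> space N)"
      using that by (auto simp: possible_histories_def history_def list_eq_iff_nth_eq less_Suc_eq_le
          simp del: upt_Suc)
    also have "\<dots> \<in> sets N"
      using S by (intro sets.finite_INT) (auto intro!: measurable_sets)
    finally show ?thesis .
  qed
  then show ?thesis
    by (subst measurable_count_space_eq_countable) (auto simp: history_possible N)
qed

lemma measurable_natural_filtration:
  "s \<le> t \<Longrightarrow> S s \<in> measurable (natural_filtration M S t) (count_space UNIV)"
  unfolding natural_filtration_def by (rule measurable_SUP_vimage_algebra) auto

lemma space_natural_filtration: "space (natural_filtration M S t) = space M"
  unfolding natural_filtration_def by (rule space_SUP_vimage_algebra) auto

lemma space_enlarged_filtration: "space (enlarged_filtration M S \<xi> t) = space M"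
proof -
  \<comment> \<open>Writing the binary supremum as the supremum of a pair makes its space the union
    of the two spaces.\<close>
  have "enlarged_filtration M S \<xi> t = Sup {natural_filtration M S t,
      SUP s\<in>{..t}. vimage_algebra (space M) (\<lambda>\<omega>. \<xi> s (history S s \<omega>) \<omega>) (count_space UNIV)}"
    by (simp add: enlarged_filtration_def)
  then show ?thesis
    by (simp only: space_Sup_eq_UN) (simp add: space_natural_filtration space_SUP_vimage_algebra)
qed

lemma possible_histories_nonempty: "possible_histories t \<noteq> {}"
  using history_possible not_empty by blast

text \<open>
  The increment is independent of the intersections of an event of the walk up to time \<open>t\<close> and
  an event of the randomization; these form an intersection-stable generator.
\<close>

lemma indep_increment_enlarged_filtration:
  assumes fam: "bernoulli_family M S q \<xi>"
  shows "indep_set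
    (sigma_sets (space M) {(\<lambda>\<omega>. S (Suc t) \<omega> - S t \<omega>) -` A \<inter> space M | A. True})
    (sets (enlarged_filtration M S \<xi> t))"
proof -
  let ?X = "\<lambda>\<omega>. S (Suc t) \<omega> - S t \<omega>"
  let ?F = "natural_filtration M S t"
  \<comment> \<open>\<open>W\<close> carries the walk at all times, hence the next increment as well
    as the past; \<open>R\<close> carries the whole randomization.\<close>
  define W where "W = (SUP t. vimage_algebra (space M) (S t) (count_space UNIV))"
  define R where "R = (SUP (t, h)\<in>(SIGMA t:UNIV. possible_histories t).
       vimage_algebra (space M) (\<xi> t h) (count_space UNIV))"
  have indep: "indep_set (sets W) (sets R)"
    using fam by (simp add: bernoulli_family_def W_def R_def Let_def)
  have ne: "(SIGMA t:(UNIV::nat set). possible_histories t) \<noteq> {}"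
    using possible_histories_nonempty by auto
  have R_eq: "R = (SUP i\<in>(SIGMA t:UNIV. possible_histories t).
       vimage_algebra (space M) ((\<lambda>(t, h). \<xi> t h) i) (count_space UNIV))"
    unfolding R_def by (intro SUP_cong) auto
  have space_R: "space R = space M"
    unfolding R_eq by (rule space_SUP_vimage_algebra[OF ne])
  have space_W: "space W = space M"
    unfolding W_def by (rule space_SUP_vimage_algebra) simp
  have S_W [measurable]: "S s \<in> measurable W (count_space UNIV)" for s
    unfolding W_def by (rule measurable_SUP_vimage_algebra) auto
  have \<xi>_R: "\<xi> s h \<in> measurable R (count_space UNIV)" if "h \<in> possible_histories s" for s h
    unfolding R_eq
    using measurable_SUP_vimage_algebra[of "(s, h)" "SIGMA t:UNIV. possible_histories t"
        "\<lambda>(t, h). \<xi> t h" "space M" "\<lambda>_. count_space UNIV"] that by auto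
  have F_W: "sets ?F \<subseteq> sets W"
    using sets_SUP_vimage_algebra_subset[of "{..t}" S W "\<lambda>_. count_space UNIV"]
    by (simp add: natural_filtration_def space_W)
  define P where "P = {A \<inter> B | A B. A \<in> sets ?F \<and> B \<in> sets R}"
  define G where "G = sigma (space M) P"
  have P_space: "P \<subseteq> Pow (space M)"
    using sets.sets_into_space[of _ R] unfolding P_def space_R by auto
  have space_G: "space G = space M"
    unfolding G_def by (rule space_measure_of[OF P_space])
  have sets_G: "sets G = sigma_sets (space M) P"
    unfolding G_def by (rule sets_measure_of[OF P_space])
  have F_G: "sets ?F \<subseteq> sets G"
  proof
    fix A assume A: "A \<in> sets ?F"
    then have "A = A \<inter> space R"
      using sets.sets_into_space[OF A] by (auto simp: space_natural_filtration space_R)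
    then have "A \<in> P" unfolding P_def using A by blast
    then show "A \<in> sets G" by (auto simp: sets_G)
  qed
  have R_G: "sets R \<subseteq> sets G"
  proof
    fix B assume B: "B \<in> sets R"
    then have "B = space ?F \<inter> B"
      using sets.sets_into_space[OF B] by (auto simp: space_natural_filtration space_R)
    then have "B \<in> P" unfolding P_def using B by blast
    then show "B \<in> sets G" by (auto simp: sets_G)
  qed
  have "indep_set (sigma_sets (space M) {?X -` A \<inter> space M | A. True}) (sigma_sets (space M) P)"
  proof (rule indep_set_sigma_sets)
    show "Int_stable {?X -` A \<inter> space M | A. True}"
    proof (rule Int_stableI)
      fix a b assume "a \<in> {?X -` A \<inter> space M | A. True}" "b \<in> {?X -` A \<inter> space M | A. True}"
      then obtain A B where "a = ?X -` A \<inter> space M" "b = ?X -` B \<inter> space M" by auto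
      then have "a \<inter> b = ?X -` (A \<inter> B) \<inter> space M" by auto
      then show "a \<inter> b \<in> {?X -` A \<inter> space M | A. True}" by blast
    qed
    show "Int_stable P"
    proof (rule Int_stableI)
      fix a b assume "a \<in> P" "b \<in> P"
      then obtain A B A' B' where "a = A \<inter> B" "b = A' \<inter> B'"
        and *: "A \<in> sets ?F" "B \<in> sets R" "A' \<in> sets ?F" "B' \<in> sets R"
        by (auto simp: P_def)
      then have "a \<inter> b = (A \<inter> A') \<inter> (B \<inter> B')" by auto
      then show "a \<inter> b \<in> P"
        unfolding P_def using * by blast
    qed
    show "indep_set {?X -` A \<inter> space M | A. True} P"
    proof (rule indep_setI)
      show "{?X -` A \<inter> space M | A. True} \<subseteq> events"
        using measurable_sets[OF measurable_increment] by auto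
      show "P \<subseteq> events"
        using F_W indep_setD_ev1[OF indep] indep_setD_ev2[OF indep] by (auto simp: P_def)
      fix a b assume "a \<in> {?X -` A \<inter> space M | A. True}" "b \<in> P"
      then obtain C A B where a: "a = ?X -` C \<inter> space M" and b: "b = A \<inter> B"
        and A: "A \<in> sets ?F" and B: "B \<in> sets R"
        by (auto simp: P_def)
      have "?X \<in> measurable W (count_space UNIV)" by measurable
      then have a_W: "a \<in> sets W"
        using measurable_sets[of ?X W "count_space UNIV" C] by (simp add: a space_W)
      \<comment> \<open>Independence is used three times: \<open>a \<inter> A\<close> lies in
        \<open>W\<close> and splits from \<open>B\<close>, then \<open>a\<close> splits from the
        past event \<open>A\<close>, and finally \<open>A\<close> and \<open>B\<close> are joined
        again.\<close>
      have "prob (a \<inter> b) = prob ((a \<inter> A) \<inter> B)" by (simp add: b Int_assoc)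
      also have "\<dots> = prob (a \<inter> A) * prob B"
        using a_W A B F_W by (intro indep_setD[OF indep]) auto
      also have "prob (a \<inter> A) = prob a * prob A"
        using A a by (intro indep_setD[OF indep_increment_natural_filtration[of t]]) auto
      also have "prob a * prob A * prob B = prob a * prob (A \<inter> B)"
        using A B F_W by (subst indep_setD[OF indep]) auto
      finally show "prob (a \<inter> b) = prob a * prob b" by (simp add: b)
    qed
  qed
  moreover have "sets (enlarged_filtration M S \<xi> t) \<subseteq> sets G"
  proof -
    let ?E = "SUP s\<in>{..t}. vimage_algebra (space M) (\<lambda>\<omega>. \<xi> s (history S s \<omega>) \<omega>) (count_space UNIV)"
    \<comment> \<open>The Bernoulli variable picked by the random history is glued from the
      countably many variables \<open>\<xi> s h\<close> along the events that the history is
      \<open>h\<close>.\<close>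
    have "(\<lambda>\<omega>. \<xi> s (history S s \<omega>) \<omega>) \<in> measurable G (count_space UNIV)" if "s \<le> t" for s
    proof (rule measurable_compose_countable'[where I = "possible_histories s"])
      show "history S s \<in> measurable G (count_space (possible_histories s))"
      proof (rule measurable_history[OF space_G])
        fix r assume "r \<le> s"
        then have "S r \<in> measurable ?F (count_space UNIV)"
          using that by (intro measurable_natural_filtration) auto
        then show "S r \<in> measurable G (count_space UNIV)"
          using measurable_mono[OF _ _ F_G] by (auto simp: space_G space_natural_filtration)
      qed
      show "\<xi> s h \<in> measurable G (count_space UNIV)" if "h \<in> possible_histories s" for h
        using measurable_mono[OF _ _ R_G] \<xi>_R[OF that] by (auto simp: space_G space_R)
    qed simp
    then have "sets ?E \<subseteq> sets G"
      using sets_SUP_vimage_algebra_subset[of "{..t}" "\<lambda>s \<omega>. \<xi> s (history S s \<omega>) \<omega>" G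
          "\<lambda>_. count_space UNIV"] by (simp add: space_G)
    then have "sets (Sup {?F, ?E}) \<subseteq> sets G"
      using F_G by (intro sets_Sup_in_sets)
        (auto simp: space_G space_natural_filtration space_SUP_vimage_algebra)
    then show ?thesis by (simp add: enlarged_filtration_def)
  qed
  ultimately show ?thesis
    unfolding sets_G by (rule indep_set_mono[OF _ order_refl])
qed

lemma measurable_enlarged_filtration:
  assumes "f \<in> measurable (natural_filtration M S t) N"
  shows "f \<in> measurable (enlarged_filtration M S \<xi> t) N"
proof -
  let ?E = "SUP s\<in>{..t}. vimage_algebra (space M) (\<lambda>\<omega>. \<xi> s (history S s \<omega>) \<omega>) (count_space UNIV)"
  have "f \<in> measurable (Sup {natural_filtration M S t, ?E}) N"
    by (rule measurable_Sup1[OF _ assms])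
       (auto simp: space_natural_filtration space_SUP_vimage_algebra)
  then show ?thesis by (simp add: enlarged_filtration_def)
qed

text \<open>Independence of two families of sets includes that their members are events.\<close>

lemma sets_enlarged_filtration_subset:
  assumes "bernoulli_family M S q \<xi>"
  shows "sets (enlarged_filtration M S \<xi> t) \<subseteq> events"
  using indep_setD_ev2[OF indep_increment_enlarged_filtration[OF assms]] .

section \<open>The exponential martingale of the stopped walk\<close>

text \<open>The ratio \<open>(1 - p) / p\<close> is the nontrivial solution of \<open>p * x + (1 - p) / x = 1\<close>.\<close>

lemma nn_integral_powr_increment:
  assumes p: "0 < p" "p < 1" and \<rho>: "\<rho> = (1 - p) / p"
  shows "(\<integral>\<^sup>+\<omega>. ennreal (\<rho> powr of_int (S (Suc t) \<omega> - S t \<omega>)) \<partial>M) = 1"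
proof -
  let ?A = "\<lambda>x. {\<omega> \<in> space M. S (Suc t) \<omega> - S t \<omega> = x}"
  have A: "?A x \<in> events" for x
    using measurable_sets[OF measurable_increment[of t], of "{x}"]
    by (simp add: vimage_def Int_def conj_commute)
  have "0 < \<rho>" using p \<rho> by simp
  have "(\<integral>\<^sup>+\<omega>. ennreal (\<rho> powr of_int (S (Suc t) \<omega> - S t \<omega>)) \<partial>M)
      = (\<integral>\<^sup>+\<omega>. ennreal \<rho> * indicator (?A 1) \<omega> + ennreal (1 / \<rho>) * indicator (?A (- 1)) \<omega> \<partial>M)"
  proof (rule nn_integral_cong)
    fix \<omega> assume "\<omega> \<in> space M"
    then show "ennreal (\<rho> powr of_int (S (Suc t) \<omega> - S t \<omega>))
        = ennreal \<rho> * indicator (?A 1) \<omega> + ennreal (1 / \<rho>) * indicator (?A (- 1)) \<omega>"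
      using step[of \<omega> t] \<open>0 < \<rho>\<close> by (auto simp: powr_minus_divide indicator_def simp del: of_int_diff)
  qed
  also have "\<dots> = ennreal \<rho> * emeasure M (?A 1) + ennreal (1 / \<rho>) * emeasure M (?A (- 1))"
    using A by (subst nn_integral_add) (auto simp: nn_integral_cmult_indicator)
  also have "\<dots> = ennreal (\<rho> * p + 1 / \<rho> * (1 - p))"
    using p \<open>0 < \<rho>\<close>
    by (simp add: emeasure_eq_measure prob_up prob_down ennreal_mult[symmetric] flip: ennreal_plus)
  also have "\<rho> * p + 1 / \<rho> * (1 - p) = 1"
    using p by (simp add: \<rho> field_simps)
  finally show ?thesis by simp
qed

text \<open>This is the one-step martingale property, tested against nonnegative weights known at
  time \<open>t\<close> instead of being phrased with conditional expectations.\<close>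

lemma nn_integral_powr_increment_mult:
  assumes p: "0 < p" "p < 1" and \<rho>: "\<rho> = (1 - p) / p"
    and fam: "bernoulli_family M S q \<xi>"
    and V: "V \<in> borel_measurable (enlarged_filtration M S \<xi> t)"
  shows "(\<integral>\<^sup>+\<omega>. ennreal (\<rho> powr of_int (S (Suc t) \<omega> - S t \<omega>)) * V \<omega> \<partial>M) = (\<integral>\<^sup>+\<omega>. V \<omega> \<partial>M)"
proof -
  let ?X = "\<lambda>\<omega>. S (Suc t) \<omega> - S t \<omega>"
  let ?U = "\<lambda>\<omega>. ennreal (\<rho> powr of_int (?X \<omega>))"
  have "indep_var borel ?U borel V"
    unfolding indep_var_eq
  proof (intro conjI)
    show "?U \<in> borel_measurable M"
      by (rule measurable_compose[OF measurable_increment]) simp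
    show "V \<in> borel_measurable M"
      using measurable_mono[OF order_refl refl sets_enlarged_filtration_subset[OF fam]] V
      by (auto simp: space_enlarged_filtration)
    show "indep_set (sigma_sets (space M) {?U -` A \<inter> space M | A. A \<in> sets borel})
        (sigma_sets (space M) {V -` A \<inter> space M | A. A \<in> sets borel})"
    proof (rule indep_set_mono[OF indep_increment_enlarged_filtration[OF fam]])
      show "sigma_sets (space M) {?U -` A \<inter> space M | A. A \<in> sets borel}
          \<subseteq> sigma_sets (space M) {?X -` A \<inter> space M | A. True}"
      proof (rule sigma_sets_mono', safe)
        fix A
        have "?U -` A \<inter> space M = ?X -` ((\<lambda>x. ennreal (\<rho> powr of_int x)) -` A) \<inter> space M"
          by auto
        then show "\<exists>B. ?U -` A \<inter> space M = ?X -` B \<inter> space M \<and> True" by blast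
      qed
      show "sigma_sets (space M) {V -` A \<inter> space M | A. A \<in> sets borel}
          \<subseteq> sets (enlarged_filtration M S \<xi> t)"
        using measurable_sets[OF V] sets.top[of "enlarged_filtration M S \<xi> t"]
        by (intro sets.sigma_sets_subset') (auto simp: space_enlarged_filtration)
    qed
  qed
  from indep_var_nn_integral[OF this] show ?thesis
    by (simp add: nn_integral_powr_increment[OF p \<rho>] del: of_int_diff)
qed

lemma stopped_walk_eq: "\<tau> \<omega> = enat n \<Longrightarrow> n \<le> t \<Longrightarrow> stopped_walk S \<tau> t \<omega> = of_int (S n \<omega>)"
  by (simp add: stopped_walk_def min_def)

text \<open>Not having stopped by time \<open>n\<close> means stopping at \<open>n + 1\<close> or
  later, so the stopped walk still agrees with the walk at time \<open>n + 1\<close>.\<close>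

lemma stopped_walk_eq': "\<not> \<tau> \<omega> \<le> enat n \<Longrightarrow> t \<le> Suc n \<Longrightarrow> stopped_walk S \<tau> t \<omega> = of_int (S t \<omega>)"
  by (cases "\<tau> \<omega>") (auto simp: stopped_walk_def min_def le_Suc_eq)

text \<open>By induction on time: paths stopped by time \<open>t\<close> keep their value, and on
  the others the next step multiplies the value by a factor of mean 1 independent of the enlarged
  filtration at time \<open>t\<close>.\<close>

lemma nn_integral_powr_stopped_walk:
  assumes p: "0 < p" "p < 1" and \<rho>: "\<rho> = (1 - p) / p"
    and fam: "bernoulli_family M S q \<xi>"
    and \<tau>: "\<And>t. Measurable.pred (enlarged_filtration M S \<xi> t) (\<lambda>\<omega>. \<tau> \<omega> \<le> enat t)"
    and meas: "\<And>t. stopped_walk S \<tau> t \<in> borel_measurable M"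
  shows "(\<integral>\<^sup>+\<omega>. ennreal (\<rho> powr stopped_walk S \<tau> t \<omega>) \<partial>M) = 1"
proof (induction t)
  case 0
  have "0 < \<rho>" using p \<rho> by simp
  have "stopped_walk S \<tau> 0 \<omega> = 0" if "\<omega> \<in> space M" for \<omega>
    using start[OF that] by (cases "\<tau> \<omega>") (auto simp: stopped_walk_def min_def)
  then have "(\<integral>\<^sup>+\<omega>. ennreal (\<rho> powr stopped_walk S \<tau> 0 \<omega>) \<partial>M) = (\<integral>\<^sup>+\<omega>. 1 \<partial>M)"
    using \<open>0 < \<rho>\<close> by (intro nn_integral_cong) simp
  then show ?case by (simp add: emeasure_space_1)
next
  case (Suc t)
  let ?G = "enlarged_filtration M S \<xi> t"
  define A where "A = {\<omega> \<in> space M. \<tau> \<omega> \<le> enat t}"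
  \<comment> \<open>\<open>V\<close> is the part of the exponential not yet stopped. Its indicator
    is known at time \<open>t\<close>, so \<open>V\<close> is an admissible weight for the one-step
    property.\<close>
  define V where "V \<omega> = ennreal (\<rho> powr of_int (S t \<omega>)) * indicator (space M - A) \<omega>" for \<omega>
  have A_G: "A \<in> sets ?G"
    using \<tau>[of t] by (simp add: pred_def A_def space_enlarged_filtration)
  have S_G: "(\<lambda>\<omega>. ennreal (\<rho> powr of_int (S t \<omega>))) \<in> borel_measurable ?G"
    by (rule measurable_compose[OF measurable_enlarged_filtration[OF
            measurable_natural_filtration[OF order_refl]]]) simp
  have B_G: "space M - A \<in> sets ?G"
    using sets.compl_sets[OF A_G] by (simp add: space_enlarged_filtration)
  have V: "V \<in> borel_measurable ?G"
    unfolding V_def by (intro borel_measurable_times_ennreal S_G borel_measurable_indicator B_G)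
  then have V_M [measurable]: "V \<in> borel_measurable M"
    using measurable_mono[OF order_refl refl sets_enlarged_filtration_subset[OF fam]]
    by (auto simp: space_enlarged_filtration)
  have A_M [measurable]: "A \<in> events"
    using A_G sets_enlarged_filtration_subset[OF fam] by auto
  have U_M [measurable]: "(\<lambda>\<omega>. ennreal (\<rho> powr of_int (S (Suc t) \<omega> - S t \<omega>))) \<in> borel_measurable M"
    by (rule measurable_compose[OF measurable_increment]) simp
  note [measurable] = meas
  let ?Y = "\<lambda>\<omega>. ennreal (\<rho> powr stopped_walk S \<tau> t \<omega>) * indicator A \<omega>"
  have after: "ennreal (\<rho> powr stopped_walk S \<tau> (Suc t) \<omega>)
      = ?Y \<omega> + ennreal (\<rho> powr of_int (S (Suc t) \<omega> - S t \<omega>)) * V \<omega>"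
    and before: "ennreal (\<rho> powr stopped_walk S \<tau> t \<omega>) = ?Y \<omega> + V \<omega>"
    if \<omega>: "\<omega> \<in> space M" for \<omega>
  proof -
    have "ennreal (\<rho> powr stopped_walk S \<tau> (Suc t) \<omega>)
        = ?Y \<omega> + ennreal (\<rho> powr of_int (S (Suc t) \<omega> - S t \<omega>)) * V \<omega> \<and>
        ennreal (\<rho> powr stopped_walk S \<tau> t \<omega>) = ?Y \<omega> + V \<omega>"
    proof (cases "\<omega> \<in> A")
      case True
      then obtain n where "\<tau> \<omega> = enat n" "n \<le> t"
        by (cases "\<tau> \<omega>") (auto simp: A_def)
      then show ?thesis using True by (simp add: V_def stopped_walk_eq)
    next
      case False
      then have "\<not> \<tau> \<omega> \<le> enat t" using \<omega> by (simp add: A_def)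
      then show ?thesis
        using False \<omega> by (simp add: V_def stopped_walk_eq' flip: ennreal_mult' powr_add)
    qed
    then show "ennreal (\<rho> powr stopped_walk S \<tau> (Suc t) \<omega>)
      = ?Y \<omega> + ennreal (\<rho> powr of_int (S (Suc t) \<omega> - S t \<omega>)) * V \<omega>"
      "ennreal (\<rho> powr stopped_walk S \<tau> t \<omega>) = ?Y \<omega> + V \<omega>" by auto
  qed
  have "(\<integral>\<^sup>+\<omega>. ennreal (\<rho> powr stopped_walk S \<tau> (Suc t) \<omega>) \<partial>M)
      = (\<integral>\<^sup>+\<omega>. ?Y \<omega> \<partial>M) + (\<integral>\<^sup>+\<omega>. ennreal (\<rho> powr of_int (S (Suc t) \<omega> - S t \<omega>)) * V \<omega> \<partial>M)"
    by (subst nn_integral_add[symmetric]) (auto intro!: nn_integral_cong after simp del: of_int_diff)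
  also have "\<dots> = (\<integral>\<^sup>+\<omega>. ?Y \<omega> \<partial>M) + (\<integral>\<^sup>+\<omega>. V \<omega> \<partial>M)"
    using nn_integral_powr_increment_mult[OF p \<rho> fam V] by simp
  also have "\<dots> = (\<integral>\<^sup>+\<omega>. ennreal (\<rho> powr stopped_walk S \<tau> t \<omega>) \<partial>M)"
    by (subst nn_integral_add[symmetric]) (auto intro!: nn_integral_cong before[symmetric])
  finally show ?case using Suc by simp
qed

section \<open>The terminal value as a limit, and Fatou's lemma\<close>

text \<open>The terminal value is the pointwise limit of the stopped walk with its value replaced by
  \<open>-\<infinity>\<close> as long as stopping has not occurred. This replacement gives the right
  limit on paths that never stop.\<close>

lemma measurable_terminal_value:
  assumes \<tau>: "\<And>t. Measurable.pred M (\<lambda>\<omega>. \<tau> \<omega> \<le> enat t)"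
    and meas: "\<And>t. stopped_walk S \<tau> t \<in> borel_measurable M"
  shows "terminal_value S \<tau> \<in> borel_measurable M"
proof -
  note [measurable] = \<tau> meas
  let ?T = "\<lambda>t \<omega>. if \<tau> \<omega> \<le> enat t then ereal (stopped_walk S \<tau> t \<omega>) else - \<infinity>"
  have "terminal_value S \<tau> = (\<lambda>\<omega>. liminf (\<lambda>t. ?T t \<omega>))"
  proof
    fix \<omega>
    have "(\<lambda>t. ?T t \<omega>) \<longlonglongrightarrow> terminal_value S \<tau> \<omega>"
    proof (cases "\<tau> \<omega>")
      case (enat n)
      have "\<forall>\<^sub>F t in sequentially. ?T t \<omega> = terminal_value S \<tau> \<omega>"
        using eventually_ge_at_top[of n]
        by eventually_elim (simp add: enat stopped_walk_eq terminal_value_def)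
      then show ?thesis by (rule tendsto_eventually)
    qed (simp add: terminal_value_def)
    then show "terminal_value S \<tau> \<omega> = liminf (\<lambda>t. ?T t \<omega>)"
      by (simp add: lim_imp_Liminf)
  qed
  then show ?thesis by simp
qed

text \<open>On almost every path the stopped walk is eventually constant, so \<open>f\<close> of it
  converges for any measurable \<open>f\<close>, and Fatou's lemma passes the bound to the limit.
  The value 0 that \<open>real_of_ereal\<close> gives to \<open>-\<infinity>\<close> is taken only
  on a null set.\<close>

lemma nn_integral_terminal_value_le:
  fixes f :: "real \<Rightarrow> ennreal"
  assumes meas: "\<And>t. stopped_walk S \<tau> t \<in> borel_measurable M"
    and f [measurable]: "f \<in> borel_measurable borel"
    and fin: "AE \<omega> in M. \<tau> \<omega> \<noteq> \<infinity>"
    and le: "\<And>t. (\<integral>\<^sup>+\<omega>. f (stopped_walk S \<tau> t \<omega>) \<partial>M) \<le> C"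
  shows "(\<integral>\<^sup>+\<omega>. f (real_of_ereal (terminal_value S \<tau> \<omega>)) \<partial>M) \<le> C"
proof -
  note [measurable] = meas
  have "f (real_of_ereal (terminal_value S \<tau> \<omega>)) = liminf (\<lambda>t. f (stopped_walk S \<tau> t \<omega>))"
    if finite: "\<tau> \<omega> \<noteq> \<infinity>" for \<omega>
  proof -
    obtain n where n: "\<tau> \<omega> = enat n" using finite by auto
    have "\<forall>\<^sub>F t in sequentially.
        f (stopped_walk S \<tau> t \<omega>) = f (real_of_ereal (terminal_value S \<tau> \<omega>))"
      using eventually_ge_at_top[of n]
      by eventually_elim (simp add: n stopped_walk_eq terminal_value_def)
    then have "(\<lambda>t. f (stopped_walk S \<tau> t \<omega>)) \<longlonglongrightarrow> f (real_of_ereal (terminal_value S \<tau> \<omega>))"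
      by (rule tendsto_eventually)
    then show ?thesis by (simp add: lim_imp_Liminf)
  qed
  then have "(\<integral>\<^sup>+\<omega>. f (real_of_ereal (terminal_value S \<tau> \<omega>)) \<partial>M)
      = (\<integral>\<^sup>+\<omega>. liminf (\<lambda>t. f (stopped_walk S \<tau> t \<omega>)) \<partial>M)"
    using fin by (intro nn_integral_cong_AE) auto
  also have "\<dots> \<le> liminf (\<lambda>t. \<integral>\<^sup>+\<omega>. f (stopped_walk S \<tau> t \<omega>) \<partial>M)"
    by (rule nn_integral_liminf) measurable
  also have "\<dots> \<le> C"
    using le by (intro Liminf_le) auto
  finally show ?thesis .
qed

section \<open>Moment conditions for attainable laws\<close>

lemma attainable_subset_candidate:
  assumes p: "0 < p" "p < 1" and \<rho>: "\<rho> = (1 - p) / p"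
  shows "attainable_laws M S \<subseteq> candidate_laws \<rho>"
proof
  fix \<mu> assume "\<mu> \<in> attainable_laws M S"
  then obtain \<tau> q \<xi> where sets_\<mu>: "sets \<mu> = UNIV" and prob: "prob_space \<mu>"
    and fam: "bernoulli_family M S q \<xi>"
    and \<tau>: "\<And>t. Measurable.pred (enlarged_filtration M S \<xi> t) (\<lambda>\<omega>. \<tau> \<omega> \<le> enat t)"
    and law: "distr M borel (terminal_value S \<tau>) = distr \<mu> borel (\<lambda>y. ereal (of_int y))"
    and ui: "uniformly_integrable M UNIV (stopped_walk S \<tau>)"
    by (auto simp: attainable_laws_def randomized_stopping_time_def)
  interpret \<mu>: prob_space \<mu> by fact
  have [measurable]: "(\<lambda>y. ereal (of_int y)) \<in> borel_measurable \<mu>"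
    "(of_int :: int \<Rightarrow> real) \<in> borel_measurable \<mu>"
    using sets_\<mu> by (auto simp: measurable_def)
  have meas: "stopped_walk S \<tau> t \<in> borel_measurable M" for t
    using ui by (simp add: uniformly_integrable_def)
  have \<tau>_M: "Measurable.pred M (\<lambda>\<omega>. \<tau> \<omega> \<le> enat t)" for t
    using \<tau>[of t] sets_enlarged_filtration_subset[OF fam, of t]
    by (auto simp: pred_def space_enlarged_filtration)
  have T [measurable]: "terminal_value S \<tau> \<in> borel_measurable M"
    by (rule measurable_terminal_value[OF \<tau>_M meas])
  \<comment> \<open>The image of \<mu> charges only integers, so equality of the laws rules out the
    terminal value \<open>-\<infinity>\<close> almost surely.\<close>
  have "AE x in distr \<mu> borel (\<lambda>y. ereal (of_int y)). x \<noteq> - \<infinity>"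
    by (subst AE_distr_iff) auto
  then have "AE x in distr M borel (terminal_value S \<tau>). x \<noteq> - \<infinity>"
    by (simp only: law)
  then have "AE \<omega> in M. terminal_value S \<tau> \<omega> \<noteq> - \<infinity>"
    by (subst (asm) AE_distr_iff) auto
  then have fin: "AE \<omega> in M. \<tau> \<omega> \<noteq> \<infinity>"
    by eventually_elim (auto simp: terminal_value_def split: enat.splits)
  \<comment> \<open>A bound valid at all times for the stopped walk passes to the terminal value
    and, through the common law on the extended reals, to \<mu>. It is applied to the absolute value
    and to the exponential.\<close>
  have transfer: "(\<integral>\<^sup>+y. f (of_int y) \<partial>\<mu>) \<le> C"
    if [measurable]: "f \<in> borel_measurable borel"
      and "\<And>t. (\<integral>\<^sup>+\<omega>. f (stopped_walk S \<tau> t \<omega>) \<partial>M) \<le> C" for f :: "real \<Rightarrow> ennreal" and C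
  proof -
    have "(\<integral>\<^sup>+y. f (of_int y) \<partial>\<mu>)
        = (\<integral>\<^sup>+x. f (real_of_ereal x) \<partial>distr \<mu> borel (\<lambda>y. ereal (of_int y)))"
      by (subst nn_integral_distr) auto
    also have "\<dots> = (\<integral>\<^sup>+\<omega>. f (real_of_ereal (terminal_value S \<tau> \<omega>)) \<partial>M)"
      by (subst law[symmetric], subst nn_integral_distr) auto
    also have "\<dots> \<le> C"
      by (rule nn_integral_terminal_value_le[OF meas _ fin]) (use that in auto)
    finally show ?thesis .
  qed
  obtain C :: real where C: "\<And>t. (\<integral>\<^sup>+\<omega>. ennreal \<bar>stopped_walk S \<tau> t \<omega>\<bar> \<partial>M) \<le> ennreal C"
    using uniformly_integrable_bounded[OF prob_space_axioms ui] by auto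
  have "(\<integral>\<^sup>+y. ennreal \<bar>of_int y\<bar> \<partial>\<mu>) \<le> ennreal C"
    by (rule transfer[OF _ C]) measurable
  then have int_abs: "integrable \<mu> (\<lambda>y. \<bar>real_of_int y\<bar>)"
    by (intro integrableI_nonneg) (auto simp: le_less_trans[OF _ ennreal_less_top])
  have le_1: "(\<integral>\<^sup>+y. ennreal (\<rho> powr of_int y) \<partial>\<mu>) \<le> 1"
    by (rule transfer)
       (use nn_integral_powr_stopped_walk[OF p \<rho> fam \<tau> meas] in \<open>auto intro: eq_refl\<close>)
  then have int_powr: "integrable \<mu> (\<lambda>y. \<rho> powr real_of_int y)"
    by (intro integrableI_nonneg) (auto simp: le_less_trans[OF _ ennreal_one_less_top])
  have "integral\<^sup>L \<mu> (\<lambda>y. \<rho> powr real_of_int y) \<le> 1"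
    using le_1 by (subst (asm) nn_integral_eq_integral[OF int_powr]) auto
  \<comment> \<open>Since \<mu> has mass 1, subtracting 1 from the exponential lowers its integral
    by exactly 1.\<close>
  then have int_g: "integrable \<mu> (\<lambda>y. g \<rho> (of_int y))" "integral\<^sup>L \<mu> (\<lambda>y. g \<rho> (of_int y)) \<le> 0"
    using int_powr by (simp_all add: g_def \<mu>.prob_space)
  show "\<mu> \<in> candidate_laws \<rho>"
    using integral_countable_infsum[OF \<mu>.finite_measure_axioms sets_\<mu> int_abs]
      integral_countable_infsum[OF \<mu>.finite_measure_axioms sets_\<mu> int_g(1)] int_g(2)
      infsum_emeasure_singletons[OF prob sets_\<mu>]
    by (simp add: candidate_laws_def sets_\<mu>)
qed

end

theorem proposition3p1:
  fixes M :: "'a measure" and S :: "nat \<Rightarrow> 'a \<Rightarrow> int" and p \<rho> :: real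
  assumes "0 < p" and "p < 1 / 2"
    and "\<rho> = (1 - p) / p"
    and "rich_asymmetric_walk M S p"
  shows "attainable_laws M S \<subseteq> candidate_laws \<rho>"
  using rich_asymmetric_walk.attainable_subset_candidate[OF assms(4)] assms(1-3) by simp

end
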